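(* Let $\beta>0$. There exists a unique pair of functions $A,B:\mathbb N_0^3\to\mathbb R$, extended by zero to $\mathbb Z^3$, such that $A_{(0,0,0)}=1$ and, for all $n=(n_1,n_2,n_3)\in\mathbb Z^3$ and all $\{j,k,\ell\}=\{1,2,3\}$, $$(\mathcal L_\ell A)_n=(\nabla_j\nabla_kB)_n,$$ $$(2n_jn_k+\beta n_j+\beta n_k-\beta n_\ell)A_n=B_{n-e_\ell}+B_{n-e_\ell-e_j-e_k}-B_{n-e_j}-B_{n-e_k}.$$ Moreover: (i) $A$ and $B$ are symmetric. (ii) $(\mathcal H_jA)_n=(\mathcal H_kA)_n$ for all $n\in\mathbb Z^3$ and $j,k\in\{1,2,3\}$. (iii) For any $n_1,n_2\in\mathbb N_0$, $$A_{(n_1,n_2,0)}=\frac{(\beta)_{n_1}(\beta)_{n_2}(1-\beta)_{n_1+n_2}}{(1)_{n_1}(1)_{n_2}(3\beta)_{n_1+n_2}},\qquad B_{(n_1,n_2,0)}=-\frac{(\beta)_{n_1+1}(\beta)_{n_2+1}(1-\beta)_{n_1+n_2+1}}{(1)_{n_1}(1)_{n_2}(3\beta)_{n_1+n_2+1}}.$$ (iv) For any $n\in\mathbb Z^3$ and $\{j,k,\ell\}=\{1,2,3\}$, $$(P^jM^jA)_{n+e_j}-(P^kM^kA)_{n+e_k}=-((P^j-P^k)M^\ell A)_n,$$ $$(P^jTA)_{n+e_j}-(Q^kM^\ell A)_{n-e_k}=((P^k+Q^j)M^kA)_n,$$ $$(Q^jM^kA)_{n-e_j}-(Q^kM^jA)_{n-e_k}=((P^j-P^k)TA)_n.$$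 (v) For $\{j,k,\ell\}=\{1,2,3\}$ define functions on $\mathbb N_0^3$ by $$X^{j,+}_n:=(P^jM^jTA)_{n+e_j}+\big((P^j+2\beta-\tfrac12)M^kM^\ell A\big)_n,$$ $$X^{j,-}_n:=(Q^jM^kM^\ell A)_{n-e_j}+\big((P^j-\beta+\tfrac12)M^jTA\big)_n.$$ Then the six functions $X^{j,+},X^{j,-}$, $j\in\{1,2,3\}$, are all equal. (vi) For any $n\in\mathbb Z^3$ and $\{j,k,\ell\}=\{1,2,3\}$, $$-2(\nabla_\ell B)_n=(P^jM^jA)_{n+e_j}+(Q^jM^\ell A)_n=(P^kM^kA)_{n+e_k}+(Q^kM^\ell A)_n$$ $$=(P^jTA)_{n+e_j+e_k}-(Q^jM^kA)_{n+e_k}=(P^kTA)_{n+e_j+e_k}-(Q^kM^jA)_{n+e_j}.$$ (vii) If $\beta\in\mathbb N$, then $A_n=0$ when $\max\{M^j_n:j\in\{1,2,3\}\}\ge1$, and $B_n=0$ when $\max\{M^j_n:j\in\{1,2,3\}\}\ge0$. So there are only finitely many $n$ such that $A_n\ne0$ or $B_n\neq0$.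
   Context: Notation. $\mathbb N=\{1,2,\dots\}$, $\mathbb N_0=\{0,1,2,\dots\}$, $(q)_m=q(q+1)\cdots(q+m-1)$ with $(q)_0=1$ is the Pochhammer symbol, $e_j$ is the $j$-th unit vector of $\mathbb Z^3$, $|n|=n_1+n_2+n_3$. Functions on $\mathbb N_0^3$ are identified with functions on $\mathbb Z^3$ vanishing outside $\mathbb N_0^3$; the value of $A$ at $n$ is $A_n$. A function on $\mathbb Z^3$ is symmetric if it is invariant under permutations of the coordinates. Products of functions on $\mathbb Z^3$ are pointwise, so e.g. $(P^jM^jA)_m=P^j_mM^j_mA_m$. For $n\in\mathbb Z^3$ and $j\in\{1,2,3\}$: $P^j_n=n_j$, $Q^j_n=n_j+\beta$, $M^j_n=|n|-2n_j+1-\beta$, $T_n=|n|-1+3\beta$. For $m\in\mathbb Z$: $f_+(m)=m(m-1+2\beta)$, $f_-(m)=(m+\beta)(m+1-\beta)$. Operators on functions on $\mathbb Z^3$: $(\nabla_jA)_n=A_n-A_{n-e_j}$, $(\mathcal L_jA)_n=f_+(n_j+1)A_{n+e_j}-f_-(n_j)A_n$, and $\mathcal H_j=\nabla_j\mathcal L_j$, i.e. $(\mathcal H_jA)_n=f_+(n_j+1)A_{n+e_j}-(f_+(n_j)+f_-(n_j))A_n+f_-(n_j-1)A_{n-e_j}$. *)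

theory Defs
  imports "HOL-Analysis.Analysis"
begin

text \<open>
  Points of the lattice \<open>\<int>\<^sup>3\<close> have type \<^typ>\<open>int ^ 3\<close>. Coordinates are indexed by the
  three-element type \<^typ>\<open>3\<close>, in which the numerals 1, 2, 3 are pairwise distinct (and 3 = 0).
  A condition \<open>{j, k, l} = UNIV\<close> on \<open>j k l :: 3\<close> says that \<open>j\<close>, \<open>k\<close>, \<open>l\<close> are the three indices
  in some order.
\<close>

abbreviation unit_vec :: "3 \<Rightarrow> int ^ 3" where
  "unit_vec j \<equiv> axis j 1"

definition octant :: "(int ^ 3) set" where
  "octant = {n. \<forall>j. 0 \<le> n $ j}"

text \<open>Functions on \<open>octant\<close> are represented by their extension by zero.\<close>

definition supported_on_octant :: "(int ^ 3 \<Rightarrow> real) \<Rightarrow> bool" where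
  "supported_on_octant F \<longleftrightarrow> (\<forall>n. n \<notin> octant \<longrightarrow> F n = 0)"

definition symmetric_fun :: "(int ^ 3 \<Rightarrow> real) \<Rightarrow> bool" where
  "symmetric_fun F \<longleftrightarrow> (\<forall>\<pi> :: 3 \<Rightarrow> 3. bij \<pi> \<longrightarrow> (\<forall>n. F (\<chi> i. n $ \<pi> i) = F n))"

text \<open>The paper writes \<open>\<bar>n\<bar>\<close> for this sum; no absolute values are taken, also for negative coordinates.\<close>

definition coord_sum :: "int ^ 3 \<Rightarrow> int" where
  "coord_sum n = (\<Sum>i\<in>UNIV. n $ i)"

definition fP :: "3 \<Rightarrow> int ^ 3 \<Rightarrow> real" where
  "fP j n = of_int (n $ j)"

definition fQ :: "real \<Rightarrow> 3 \<Rightarrow> int ^ 3 \<Rightarrow> real" where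
  "fQ \<beta> j n = of_int (n $ j) + \<beta>"

definition fM :: "real \<Rightarrow> 3 \<Rightarrow> int ^ 3 \<Rightarrow> real" where
  "fM \<beta> j n = of_int (coord_sum n) - 2 * of_int (n $ j) + 1 - \<beta>"

definition fT :: "real \<Rightarrow> int ^ 3 \<Rightarrow> real" where
  "fT \<beta> n = of_int (coord_sum n) - 1 + 3 * \<beta>"

definition f_plus :: "real \<Rightarrow> int \<Rightarrow> real" where
  "f_plus \<beta> m = of_int m * (of_int m - 1 + 2 * \<beta>)"

definition f_minus :: "real \<Rightarrow> int \<Rightarrow> real" where
  "f_minus \<beta> m = (of_int m + \<beta>) * (of_int m + 1 - \<beta>)"

definition nabla :: "3 \<Rightarrow> (int ^ 3 \<Rightarrow> real) \<Rightarrow> int ^ 3 \<Rightarrow> real" where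
  "nabla j F n = F n - F (n - unit_vec j)"

definition opL :: "real \<Rightarrow> 3 \<Rightarrow> (int ^ 3 \<Rightarrow> real) \<Rightarrow> int ^ 3 \<Rightarrow> real" where
  "opL \<beta> j F n = f_plus \<beta> (n $ j + 1) * F (n + unit_vec j) - f_minus \<beta> (n $ j) * F n"

definition opH :: "real \<Rightarrow> 3 \<Rightarrow> (int ^ 3 \<Rightarrow> real) \<Rightarrow> int ^ 3 \<Rightarrow> real" where
  "opH \<beta> j F = nabla j (opL \<beta> j F)"

lemma opH_expand:
  "opH \<beta> j F n = f_plus \<beta> (n $ j + 1) * F (n + unit_vec j)
     - (f_plus \<beta> (n $ j) + f_minus \<beta> (n $ j)) * F n
     + f_minus \<beta> (n $ j - 1) * F (n - unit_vec j)"
  by (simp add: opH_def nabla_def opL_def algebra_simps)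

definition is_solution :: "real \<Rightarrow> (int ^ 3 \<Rightarrow> real) \<Rightarrow> (int ^ 3 \<Rightarrow> real) \<Rightarrow> bool" where
  "is_solution \<beta> A B \<longleftrightarrow>
     supported_on_octant A \<and> supported_on_octant B \<and> A 0 = 1 \<and>
     (\<forall>n j k l. {j, k, l} = UNIV \<longrightarrow>
        opL \<beta> l A n = nabla j (nabla k B) n \<and>
        (2 * of_int (n $ j) * of_int (n $ k) + \<beta> * of_int (n $ j) + \<beta> * of_int (n $ k)
            - \<beta> * of_int (n $ l)) * A n
          = B (n - unit_vec l) + B (n - unit_vec l - unit_vec j - unit_vec k)
            - B (n - unit_vec j) - B (n - unit_vec k))"

text \<open>
  The indices \<open>k\<close>, \<open>l\<close> below are the two indices other than \<open>j\<close>; both functions are only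
  considered at points of \<open>octant\<close>.
\<close>

definition X_plus ::
  "real \<Rightarrow> (int ^ 3 \<Rightarrow> real) \<Rightarrow> 3 \<Rightarrow> 3 \<Rightarrow> 3 \<Rightarrow> int ^ 3 \<Rightarrow> real" where
  "X_plus \<beta> A j k l n =
     (\<lambda>m. fP j m * fM \<beta> j m * fT \<beta> m * A m) (n + unit_vec j)
     + (fP j n + 2 * \<beta> - 1/2) * fM \<beta> k n * fM \<beta> l n * A n"

definition X_minus ::
  "real \<Rightarrow> (int ^ 3 \<Rightarrow> real) \<Rightarrow> 3 \<Rightarrow> 3 \<Rightarrow> 3 \<Rightarrow> int ^ 3 \<Rightarrow> real" where
  "X_minus \<beta> A j k l n =
     (\<lambda>m. fQ \<beta> j m * fM \<beta> k m * fM \<beta> l m * A m) (n - unit_vec j)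
     + (fP j n - \<beta> + 1/2) * fM \<beta> j n * fT \<beta> n * A n"

end

theory Submission
  imports Defs
begin

text \<open>
  The second relation of (iv) has the leading factor \<open>(n\<^sub>j + 1) (\<bar>n\<bar> + 3 \<beta>)\<close>, which is positive on the
  octant, so it can be read as a recursion that computes \<open>A\<close> level by level in \<open>\<bar>n\<bar>\<close>. Its different
  instances agree by the first and third relations on lower levels, and these in turn propagate to the
  next level.

  The right-hand sides of (vi) then define a vector field on the lattice that is curl-free by the
  relations for \<open>A\<close>; its potential is \<open>B\<close>, up to the factor \<open>-2\<close>.

  Conversely, adding two of the three equations that express \<open>A\<close> by \<open>B\<close> gives
  \<open>B\<^sub>n - B\<^bsub>n-e\<^sub>j-e\<^sub>l\<^esub> = - (n\<^sub>k + 1) (n\<^sub>j + n\<^sub>l + \<beta>) A\<^bsub>n+e\<^sub>k\<^esub>\<close>. Inserting this into the equation for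
  \<open>\<L>\<^sub>l A\<close>, the coefficient of \<open>A\<^bsub>n+e\<^sub>l\<^esub>\<close> becomes \<open>(n\<^sub>l + 1) (\<bar>n\<bar> + 3 \<beta>)\<close> again, so a solution is determined
  level by level. Symmetry is a consequence of uniqueness.
\<close>

section \<open>Index triples, coordinate shifts and the octant\<close>

lemma triple_distinct:
  fixes j k l :: 3
  assumes "{j, k, l} = UNIV"
  shows "j \<noteq> k" "j \<noteq> l" "k \<noteq> l"
proof -
  have "card {j, k, l} = 3"
    using assms by simp
  then show "j \<noteq> k" "j \<noteq> l" "k \<noteq> l"
    by (auto simp: card_insert_if split: if_splits)
qed

lemma triple_perms:
  fixes j k l :: 3
  assumes "{j, k, l} = UNIV"
  shows "{k, j, l} = UNIV" "{j, l, k} = UNIV" "{l, k, j} = UNIV" "{k, l, j} = UNIV" "{l, j, k} = UNIV"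
  using assms by auto

lemma triple_succ: "{j, j + 1, j + 2} = (UNIV :: 3 set)"
proof (rule card_subset_eq)
  have "j + 1 \<noteq> j + 2" "j \<noteq> j + 1" "j \<noteq> j + 2"
    by simp_all
  then show "card {j, j + 1, j + 2} = CARD(3)"
    by (simp add: card_insert_if)
qed simp_all

lemma triple_complete:
  fixes j k :: 3
  assumes "j \<noteq> k"
  obtains l where "{j, k, l} = UNIV"
proof -
  have "k \<in> {j, j + 1, j + 2}"
    unfolding triple_succ by simp
  then have "k = j + 1 \<or> k = j + 2"
    using assms by simp
  then show thesis
    using that triple_succ[of j] triple_perms(2)[OF triple_succ[of j]] by blast
qed

lemma coord_sum_triple:
  assumes "{j, k, l} = UNIV"
  shows "coord_sum n = n $ j + n $ k + n $ l"
  unfolding coord_sum_def assms[symmetric] using triple_distinct[OF assms] by simp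

lemma coord_sum_add [simp]: "coord_sum (m + n) = coord_sum m + coord_sum n"
  and coord_sum_diff [simp]: "coord_sum (m - n) = coord_sum m - coord_sum n"
  and coord_sum_unit_vec [simp]: "coord_sum (unit_vec j) = 1"
  and coord_sum_zero [simp]: "coord_sum 0 = 0"
  by (simp_all add: coord_sum_def sum.distrib sum_subtractf axis_def)

lemma unit_vec_nth: "unit_vec j $ i = (if i = j then 1 else 0)"
  by (simp add: axis_def)

lemma shift_simps:
  "fP i (n + unit_vec j) = fP i n + (if i = j then 1 else 0)"
  "fP i (n - unit_vec j) = fP i n - (if i = j then 1 else 0)"
  "fQ \<beta> i (n + unit_vec j) = fQ \<beta> i n + (if i = j then 1 else 0)"
  "fQ \<beta> i (n - unit_vec j) = fQ \<beta> i n - (if i = j then 1 else 0)"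
  "fM \<beta> i (n + unit_vec j) = fM \<beta> i n + (if i = j then - 1 else 1)"
  "fM \<beta> i (n - unit_vec j) = fM \<beta> i n - (if i = j then - 1 else 1)"
  "fT \<beta> (n + unit_vec j) = fT \<beta> n + 1"
  "fT \<beta> (n - unit_vec j) = fT \<beta> n - 1"
  by (simp_all add: fP_def fQ_def fM_def fT_def unit_vec_nth)

text \<open>Reduces \<open>fM\<close> and \<open>fT\<close> to the three coordinate values, so that
  the later identities become polynomial in the coordinates, \<beta> and finitely many values of
  A.\<close>

lemma triple_values:
  assumes "{j, k, l} = UNIV"
  shows "fM \<beta> j n = fP k n + fP l n - fP j n + 1 - \<beta>"
    "fM \<beta> k n = fP j n + fP l n - fP k n + 1 - \<beta>"
    "fM \<beta> l n = fP j n + fP k n - fP l n + 1 - \<beta>"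
    "fT \<beta> n = fP j n + fP k n + fP l n - 1 + 3 * \<beta>"
  by (simp_all add: fM_def fP_def fT_def coord_sum_triple[OF assms])

lemma fQ_eq: "fQ \<beta> j n = fP j n + \<beta>"
  by (simp add: fQ_def fP_def)

lemma octant_coord_sum_nonneg: "n \<in> octant \<Longrightarrow> 0 \<le> coord_sum n"
  by (simp add: octant_def coord_sum_def sum_nonneg)

lemma octant_coord_sum_zero: "n \<in> octant \<Longrightarrow> coord_sum n = 0 \<Longrightarrow> n = 0"
  by (simp add: octant_def coord_sum_def sum_nonneg_eq_0_iff vec_eq_iff)

lemma octant_coord_pos: "n \<in> octant \<Longrightarrow> n \<noteq> 0 \<Longrightarrow> \<exists>j. 0 < n $ j"
  by (auto simp: octant_def vec_eq_iff order_less_le)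

lemma supported_zero: "supported_on_octant F \<Longrightarrow> n $ j < 0 \<Longrightarrow> F n = 0"
  unfolding supported_on_octant_def octant_def by (metis (lifting) mem_Collect_eq not_le)

section \<open>Implications between the relations for A at neighbouring points\<close>

text \<open>
  The three relations of (iv). The second one is kept separate for each ordering of the indices since
  it first becomes known for a single ordering, the one that defines \<open>A\<close>.
\<close>

definition rel_up :: "real \<Rightarrow> (int ^ 3 \<Rightarrow> real) \<Rightarrow> int ^ 3 \<Rightarrow> bool" where
  "rel_up \<beta> A n \<longleftrightarrow> (\<forall>j k l. {j, k, l} = UNIV \<longrightarrow>
     fP j (n + unit_vec j) * fM \<beta> j (n + unit_vec j) * A (n + unit_vec j)
       - fP k (n + unit_vec k) * fM \<beta> k (n + unit_vec k) * A (n + unit_vec k)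
     = - ((fP j n - fP k n) * fM \<beta> l n * A n))"

definition rel_mixed :: "real \<Rightarrow> (int ^ 3 \<Rightarrow> real) \<Rightarrow> 3 \<Rightarrow> 3 \<Rightarrow> 3 \<Rightarrow> int ^ 3 \<Rightarrow> bool" where
  "rel_mixed \<beta> A j k l n \<longleftrightarrow>
     fP j (n + unit_vec j) * fT \<beta> (n + unit_vec j) * A (n + unit_vec j)
       - fQ \<beta> k (n - unit_vec k) * fM \<beta> l (n - unit_vec k) * A (n - unit_vec k)
     = (fP k n + fQ \<beta> j n) * fM \<beta> k n * A n"

definition rel_down :: "real \<Rightarrow> (int ^ 3 \<Rightarrow> real) \<Rightarrow> int ^ 3 \<Rightarrow> bool" where
  "rel_down \<beta> A n \<longleftrightarrow> (\<forall>j k l. {j, k, l} = UNIV \<longrightarrow>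
     fQ \<beta> j (n - unit_vec j) * fM \<beta> k (n - unit_vec j) * A (n - unit_vec j)
       - fQ \<beta> k (n - unit_vec k) * fM \<beta> j (n - unit_vec k) * A (n - unit_vec k)
     = (fP j n - fP k n) * fT \<beta> n * A n)"

text \<open>A step up enters the octant only by raising a coordinate from -1 to 0, and there the
  factor \<open>fP j\<close> vanishes. The free factor \<open>x\<close> stands for \<open>fM\<close>
  or \<open>fT\<close>.\<close>

lemma fP_mult_supported_zero:
  assumes "supported_on_octant A" "n $ i < 0"
  shows "fP j (n + unit_vec j) * x * A (n + unit_vec j) = 0"
proof (cases "i = j \<and> n $ i = -1")
  case True
  then show ?thesis by (auto simp: fP_def unit_vec_nth)
next
  case False
  then have "(n + unit_vec j) $ i < 0"
    using assms(2) by (auto simp: unit_vec_nth)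
  then show ?thesis
    using supported_zero[OF assms(1)] by simp
qed

lemma outside_octant:
  assumes "supported_on_octant A" "n \<notin> octant"
  shows "rel_up \<beta> A n" "rel_mixed \<beta> A j k l n" "rel_down \<beta> A n"
proof -
  obtain i where i: "n $ i < 0"
    using assms(2) by (auto simp: octant_def not_le)
  have minus: "A (n - unit_vec j) = 0" for j
    by (rule supported_zero[OF assms(1), of _ i]) (use i in \<open>auto simp: unit_vec_nth\<close>)
  show "rel_up \<beta> A n" "rel_mixed \<beta> A j k l n" "rel_down \<beta> A n"
    by (simp_all add: rel_up_def rel_mixed_def rel_down_def fP_mult_supported_zero[OF assms(1) i]
        supported_zero[OF assms(1) i] minus)
qed

text \<open>Both instances contain the same term at n + e_j, which cancels in their difference; what
  remains is the downward relation for k and l, up to a polynomial identity.\<close>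

lemma rel_mixed_swap:
  assumes "{j, k, l} = UNIV" "rel_down \<beta> A n" "rel_mixed \<beta> A j k l n"
  shows "rel_mixed \<beta> A j l k n"
proof -
  have "fQ \<beta> k (n - unit_vec k) * fM \<beta> l (n - unit_vec k) * A (n - unit_vec k)
       - fQ \<beta> l (n - unit_vec l) * fM \<beta> k (n - unit_vec l) * A (n - unit_vec l)
     = (fP k n - fP l n) * fT \<beta> n * A n"
    using assms(1,2) triple_perms(4)[OF assms(1)] unfolding rel_down_def by blast
  with assms(3) show ?thesis
    unfolding rel_mixed_def fQ_eq triple_values[OF assms(1), of \<beta> n] by algebra
qed

text \<open>Both relations compute A at m, one from m - e_j, the other from m - e_k. The upward
  relation at the bottom corner of this square links A at these two points; the elimination leaves a
  factor m_j to be cancelled.\<close>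

lemma rel_mixed_transfer:
  assumes "{j, k, l} = UNIV" "m $ j \<noteq> 0"
    and "rel_up \<beta> A (m - unit_vec j - unit_vec k)" "rel_mixed \<beta> A j k l (m - unit_vec j)"
  shows "rel_mixed \<beta> A k j l (m - unit_vec k)"
proof -
  define n where "n = m - unit_vec j - unit_vec k"
  note t = triple_distinct[OF assms(1)] and p = triple_values[OF assms(1)]
  have m: "m = n + unit_vec j + unit_vec k" by (simp add: n_def)
  have nz: "fP j n + 1 \<noteq> 0"
    using assms(2) t by (simp add: m fP_def unit_vec_nth)
  have 1: "(fP j n + 1) * (fM \<beta> j n - 1) * A (n + unit_vec j)
       - (fP k n + 1) * (fM \<beta> k n - 1) * A (n + unit_vec k)
     = - ((fP j n - fP k n) * fM \<beta> l n * A n)"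
    using assms(1,3) unfolding rel_up_def n_def[symmetric] by (simp add: shift_simps)
  have eq: "m - unit_vec j = n + unit_vec k" "m - unit_vec k = n + unit_vec j"
     "n + unit_vec k + unit_vec j = m" "n + unit_vec j + unit_vec k = m" by (simp_all add: m)
  have vals: "fP j m = fP j n + 1" "fP k m = fP k n + 1" "fT \<beta> m = fT \<beta> n + 2"
    using t by (simp_all add: m shift_simps)
  have 2: "(fP j n + 1) * (fT \<beta> n + 2) * A m
       - fQ \<beta> k n * fM \<beta> l n * A n
     = (fP k n + 1 + fQ \<beta> j n) * (fM \<beta> k n - 1) * A (n + unit_vec k)"
    using assms(4) t unfolding rel_mixed_def eq vals by (simp add: shift_simps add_ac)
  \<comment> \<open>This is \<open>fP k n + 1\<close> times 2, with A at n + e_k eliminated by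
    1.\<close>
  have "(fP j n + 1) * ((fP k n + 1) * (fT \<beta> n + 2) * A m
       - fQ \<beta> j n * fM \<beta> l n * A n - 
      (fP j n + 1 + fQ \<beta> k n) * (fM \<beta> j n - 1) * A (n + unit_vec j)) = 0"
    using 1 2 unfolding fQ_eq p[of \<beta> n] by algebra
  then have "(fP k n + 1) * (fT \<beta> n + 2) * A m
       - fQ \<beta> j n * fM \<beta> l n * A n =
      (fP j n + 1 + fQ \<beta> k n) * (fM \<beta> j n - 1) * A (n + unit_vec j)"
    using nz by simp
  then show ?thesis
    using t unfolding rel_mixed_def eq vals by (simp add: shift_simps add_ac)
qed

text \<open>The mixed relations \<open>j l k\<close> and \<open>k l j\<close> share the point n -
  e_l. Eliminating A there by cross-multiplication leaves the upward relation times
  \<open>fT \<beta> n + 1\<close>, which must therefore be nonzero.\<close>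

lemma rel_up_from_mixed:
  assumes "fT \<beta> n \<noteq> -1"
    and "\<And>j k l. {j, k, l} = UNIV \<Longrightarrow> rel_mixed \<beta> A j k l n"
  shows "rel_up \<beta> A n"
  unfolding rel_up_def
proof (intro allI impI)
  fix j k l :: 3
  assume T: "{j, k, l} = UNIV"
  note t = triple_distinct[OF T] and p = triple_values[OF T]
  have 1: "(fP j n + 1) * (fT \<beta> n + 1) * A (n + unit_vec j)
      - (fQ \<beta> l n - 1) * (fM \<beta> k n - 1) * A (n - unit_vec l)
      = (fP l n + fQ \<beta> j n) * fM \<beta> l n * A n"
    using assms(2)[OF triple_perms(2)[OF T]] t unfolding rel_mixed_def by (simp add: shift_simps)
  have 2: "(fP k n + 1) * (fT \<beta> n + 1) * A (n + unit_vec k)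
      - (fQ \<beta> l n - 1) * (fM \<beta> j n - 1) * A (n - unit_vec l)
      = (fP l n + fQ \<beta> k n) * fM \<beta> l n * A n"
    using assms(2)[OF triple_perms(4)[OF T]] t unfolding rel_mixed_def by (simp add: shift_simps)
  have "(fT \<beta> n + 1) * ((fP j n + 1) * (fM \<beta> j n - 1) * A (n + unit_vec j)
       - (fP k n + 1) * (fM \<beta> k n - 1) * A (n + unit_vec k)
     + ((fP j n - fP k n) * fM \<beta> l n * A n)) = 0"
    using 1 2 unfolding fQ_eq p[of \<beta> n] by algebra
  moreover have "fT \<beta> n + 1 \<noteq> 0"
    using assms(1) by linarith
  ultimately have "(fP j n + 1) * (fM \<beta> j n - 1) * A (n + unit_vec j)
       - (fP k n + 1) * (fM \<beta> k n - 1) * A (n + unit_vec k)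
     = - ((fP j n - fP k n) * fM \<beta> l n * A n)"
    by simp
  then show "fP j (n + unit_vec j) * fM \<beta> j (n + unit_vec j) * A (n + unit_vec j)
       - fP k (n + unit_vec k) * fM \<beta> k (n + unit_vec k) * A (n + unit_vec k)
     = - ((fP j n - fP k n) * fM \<beta> l n * A n)"
    by (simp add: shift_simps)
qed

text \<open>The two mixed relations for A at m are subtracted, and A at the bottom corner n is
  removed by the upward relation. Nothing is divided, so points m with zero coordinates are
  included.\<close>

lemma rel_down_from_up_mixed:
  assumes "\<And>j k l. {j, k, l} = UNIV \<Longrightarrow> rel_mixed \<beta> A j k l (m - unit_vec j)"
    and "\<And>j k. rel_up \<beta> A (m - unit_vec j - unit_vec k)"
  shows "rel_down \<beta> A m"
  unfolding rel_down_def
proof (intro allI impI)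
  fix j k l :: 3
  assume T: "{j, k, l} = UNIV"
  note t = triple_distinct[OF T] and p = triple_values[OF T]
  define n where "n = m - unit_vec j - unit_vec k"
  have m: "m = n + unit_vec j + unit_vec k" by (simp add: n_def)
  have eq: "m - unit_vec j = n + unit_vec k" "m - unit_vec k = n + unit_vec j"
     "n + unit_vec k + unit_vec j = m"  "n + unit_vec j + unit_vec k = m" by (simp_all add: m)
  have 1: "(fP j n + 1) * (fM \<beta> j n - 1) * A (n + unit_vec j)
       - (fP k n + 1) * (fM \<beta> k n - 1) * A (n + unit_vec k)
     = - ((fP j n - fP k n) * fM \<beta> l n * A n)"
    using assms(2)[of j k] T unfolding rel_up_def n_def[symmetric] by (simp add: shift_simps)
  have vals: "fP j m = fP j n + 1" "fP k m = fP k n + 1" "fT \<beta> m = fT \<beta> n + 2"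
    using t by (simp_all add: m shift_simps)
  have 2: "(fP j n + 1) * (fT \<beta> n + 2) * A m - fQ \<beta> k n * fM \<beta> l n * A n
     = (fP k n + 1 + fQ \<beta> j n) * (fM \<beta> k n - 1) * A (n + unit_vec k)"
    using assms(1)[OF T] t unfolding rel_mixed_def eq vals by (simp add: shift_simps add_ac)
  have 3: "(fP k n + 1) * (fT \<beta> n + 2) * A m - fQ \<beta> j n * fM \<beta> l n * A n
     = (fP j n + 1 + fQ \<beta> k n) * (fM \<beta> j n - 1) * A (n + unit_vec j)"
    using assms(1)[OF triple_perms(1)[OF T]] t unfolding rel_mixed_def eq vals
    by (simp add: shift_simps add_ac)
  have "fQ \<beta> j n * (fM \<beta> k n - 1) * A (n + unit_vec k)
       - fQ \<beta> k n * (fM \<beta> j n - 1) * A (n + unit_vec j)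
     = (fP j n - fP k n) * (fT \<beta> n + 2) * A m"
    using 1 2 3 unfolding fQ_eq p[of \<beta> n] by algebra
  then show "fQ \<beta> j (m - unit_vec j) * fM \<beta> k (m - unit_vec j) * A (m - unit_vec j)
       - fQ \<beta> k (m - unit_vec k) * fM \<beta> j (m - unit_vec k) * A (m - unit_vec k)
     = (fP j m - fP k m) * fT \<beta> m * A m"
    unfolding eq vals using t by (simp add: shift_simps)
qed

section \<open>Recursive construction of A and propagation by levels\<close>

text \<open>
  The index type has characteristic 3, so \<open>j\<close>, \<open>j + 1\<close>, \<open>j + 2\<close> are the three indices.
\<close>

function solA :: "real \<Rightarrow> int ^ 3 \<Rightarrow> real" where
  "solA \<beta> m =
     (if m \<notin> octant then 0 else if m = 0 then 1 else
       let j = (SOME j. 0 < m $ j); k = j + 1; l = j + 2; n = m - unit_vec j in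
         (fQ \<beta> k (n - unit_vec k) * fM \<beta> l (n - unit_vec k) * solA \<beta> (n - unit_vec k)
          + (fP k n + fQ \<beta> j n) * fM \<beta> k n * solA \<beta> n) / (fP j m * fT \<beta> m))"
  by auto
termination
\<comment> \<open>The recursive arguments lie one and two levels below m. The level of m is
  positive, so \<open>nat\<close> decreases strictly.\<close>
proof (relation "Wellfounded.measure (\<lambda>(\<beta>, m). nat (coord_sum m))", goal_cases)
  case 1
  then show ?case by simp
next
  case (2 \<beta> m j k l n)
  then have "0 < coord_sum m"
    using octant_coord_sum_nonneg[of m] octant_coord_sum_zero[of m] by linarith
  then show ?case using 2 by auto
next
  case (3 \<beta> m j k l n)
  then have "0 < coord_sum m"
    using octant_coord_sum_nonneg[of m] octant_coord_sum_zero[of m] by linarith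
  then show ?case using 3 by auto
qed

declare solA.simps [simp del]

lemma zero_in_octant: "0 \<in> octant"
  by (simp add: octant_def)

lemma supported_solA: "supported_on_octant (solA \<beta>)"
  by (simp add: supported_on_octant_def solA.simps)

lemma solA_zero: "solA \<beta> 0 = 1"
  by (simp add: solA.simps zero_in_octant)

lemma fT_succ_pos: "\<beta> > 0 \<Longrightarrow> 0 \<le> coord_sum n \<Longrightarrow> 0 < fT \<beta> n + 1"
  by (simp add: fT_def)

lemma solA_step:
  assumes "\<beta> > 0" "m \<in> octant" "m \<noteq> 0"
  obtains j where "0 < m $ j" "rel_mixed \<beta> (solA \<beta>) j (j + 1) (j + 2) (m - unit_vec j)"
proof -
  define j where "j = (SOME j. 0 < m $ j)"
  have j: "0 < m $ j"
    unfolding j_def using octant_coord_pos[OF assms(2,3)] by (rule someI_ex)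
  have "0 < coord_sum m"
    using assms octant_coord_sum_nonneg[of m] octant_coord_sum_zero[of m] by linarith
  then have "fP j m * fT \<beta> m \<noteq> 0"
    using j assms(1) by (auto simp: fP_def fT_def)
  then have "rel_mixed \<beta> (solA \<beta>) j (j + 1) (j + 2) (m - unit_vec j)"
    unfolding rel_mixed_def using assms
    by (simp add: solA.simps[of \<beta> m] j_def[symmetric] Let_def)
  with j that show thesis by blast
qed

text \<open>Independence of the choice made in the recursion: a swap yields both orderings for the
  chosen index i, a transfer moves the relation from i to j, and a second swap gives the remaining
  ordering.\<close>

lemma rel_mixed_all:
  assumes b: "\<beta> > 0" and m: "m \<in> octant" "m \<noteq> 0"
    and r1: "\<And>j k. rel_up \<beta> (solA \<beta>) (m - unit_vec j - unit_vec k)"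
    and r3: "\<And>j. rel_down \<beta> (solA \<beta>) (m - unit_vec j)"
    and T: "{j, k, l} = UNIV"
  shows "rel_mixed \<beta> (solA \<beta>) j k l (m - unit_vec j)"
proof (cases "m $ j = 0")
  case True
  then have "(m - unit_vec j) $ j < 0"
    by (simp add: unit_vec_nth)
  then have "m - unit_vec j \<notin> octant"
    unfolding octant_def by (metis (lifting) mem_Collect_eq not_le)
  then show ?thesis using outside_octant supported_solA by blast
next
  case False
  obtain i where i: "0 < m $ i" and ri: "rel_mixed \<beta> (solA \<beta>) i (i + 1) (i + 2) (m - unit_vec i)"
    using solA_step[OF b m] .
  have all_i: "rel_mixed \<beta> (solA \<beta>) i p q (m - unit_vec i)" if "{i, p, q} = UNIV" for p q
  proof -
    have "p \<in> {i, i + 1, i + 2}" "q \<in> {i, i + 1, i + 2}"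
      unfolding triple_succ by simp_all
    then have "p = i + 1 \<and> q = i + 2 \<or> p = i + 2 \<and> q = i + 1"
      using triple_distinct[OF that] by blast
    then show ?thesis
      using ri rel_mixed_swap[OF triple_succ r3 ri] by auto
  qed
  show ?thesis
  proof (cases "i = j")
    case True
    then show ?thesis using all_i T by blast
  next
    case False
    \<comment> \<open>The third index next to i and j, so that (k, l) is (i, p) or (p, i).\<close>
    define p where "p = (if k = i then l else k)"
    have "i \<in> {j, k, l}"
      unfolding T by simp
    then have cases: "k = i \<and> l = p \<or> k = p \<and> l = i"
      using triple_distinct[OF T] False by (auto simp: p_def)
    then have T': "{i, j, p} = UNIV"
      using triple_perms[OF T] by blast
    have r: "rel_mixed \<beta> (solA \<beta>) j i p (m - unit_vec j)"
      using rel_mixed_transfer[OF T' _ r1 all_i[OF T']] i by simp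
    then show ?thesis
      using cases rel_mixed_swap[OF triple_perms(1)[OF T'] r3 r] by auto
  qed
qed

text \<open>The downward relation is kept one level ahead. From it at level N and the upward
  relation at level N - 1 follow, in turn, the mixed and the upward relation at level N and the
  downward relation at level N + 1.\<close>

lemma solA_levels:
  assumes "\<beta> > 0"
  shows "(\<forall>n. coord_sum n < int N \<longrightarrow> rel_up \<beta> (solA \<beta>) n \<and>
            (\<forall>j k l. {j, k, l} = UNIV \<longrightarrow> rel_mixed \<beta> (solA \<beta>) j k l n)) \<and>
         (\<forall>n. coord_sum n \<le> int N \<longrightarrow> rel_down \<beta> (solA \<beta>) n)"
proof (induction N)
  case 0
  have "rel_down \<beta> (solA \<beta>) 0"
    using supported_zero[OF supported_solA]
    by (simp add: rel_down_def fP_def unit_vec_nth)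
  have "rel_down \<beta> (solA \<beta>) n" if "coord_sum n \<le> 0" for n
  proof (cases "n \<in> octant")
    case True
    then have "n = 0"
      using that octant_coord_sum_nonneg[of n] octant_coord_sum_zero[of n] by linarith
    then show ?thesis
      using \<open>rel_down \<beta> (solA \<beta>) 0\<close> by simp
  qed (rule outside_octant[OF supported_solA])
  moreover have "n \<notin> octant" if "coord_sum n < 0" for n
    using that octant_coord_sum_nonneg[of n] by auto
  ultimately show ?case
    using outside_octant[OF supported_solA] by simp
next
  case (Suc N)
  have ih1: "rel_up \<beta> (solA \<beta>) n" if "coord_sum n < int N" for n
    using Suc that by blast
  have ih3: "rel_down \<beta> (solA \<beta>) n" if "coord_sum n \<le> int N" for n
    using Suc that by blast
  have r2: "rel_mixed \<beta> (solA \<beta>) j k l n" if lt: "coord_sum n < int (Suc N)" and T: "{j, k, l} = UNIV" for n j k l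
  proof (cases "n \<in> octant")
    case True
    have pos: "0 < coord_sum (n + unit_vec j)"
      using octant_coord_sum_nonneg[OF True] by simp
    have m: "n + unit_vec j \<in> octant"
      using True by (auto simp: octant_def unit_vec_nth)
    have nz: "n + unit_vec j \<noteq> 0"
      using pos by (metis coord_sum_zero less_irrefl)
    have "rel_mixed \<beta> (solA \<beta>) j k l (n + unit_vec j - unit_vec j)"
      by (rule rel_mixed_all[OF assms m nz _ _ T]; (rule ih1 | rule ih3)) (use lt in simp_all)
    then show ?thesis
      by simp
  qed (rule outside_octant[OF supported_solA])
  have r1: "rel_up \<beta> (solA \<beta>) n" if "coord_sum n < int (Suc N)" for n
  proof (cases "n \<in> octant")
    case True
    show ?thesis
    proof (rule rel_up_from_mixed)
      show "fT \<beta> n \<noteq> -1"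
        using fT_succ_pos[OF assms octant_coord_sum_nonneg[OF True]] by simp
    qed (rule r2[OF that])
  qed (rule outside_octant[OF supported_solA])
  have r3: "rel_down \<beta> (solA \<beta>) n" if "coord_sum n \<le> int (Suc N)" for n
  proof (rule rel_down_from_up_mixed)
    show "rel_mixed \<beta> (solA \<beta>) j k l (n - unit_vec j)" if "{j, k, l} = UNIV" for j k l
      by (rule r2[OF _ that]) (use \<open>coord_sum n \<le> int (Suc N)\<close> in simp)
    show "rel_up \<beta> (solA \<beta>) (n - unit_vec j - unit_vec k)" for j k
      by (rule r1) (use that in simp)
  qed
  show ?case
    using r1 r2 r3 by blast
qed

lemma solA_rel:
  assumes "\<beta> > 0"
  shows "rel_up \<beta> (solA \<beta>) n" "{j, k, l} = UNIV \<Longrightarrow> rel_mixed \<beta> (solA \<beta>) j k l n" "rel_down \<beta> (solA \<beta>) n"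
proof -
  have lt: "coord_sum n < int (nat (coord_sum n + 1))" and le: "coord_sum n \<le> int (nat (coord_sum n + 1))"
    by simp_all
  note levels = solA_levels[OF assms, of "nat (coord_sum n + 1)"]
  show "rel_up \<beta> (solA \<beta>) n" "{j, k, l} = UNIV \<Longrightarrow> rel_mixed \<beta> (solA \<beta>) j k l n"
    using levels lt by blast+
  show "rel_down \<beta> (solA \<beta>) n"
    using levels le by blast
qed

section \<open>The flux and its potential B\<close>

text \<open>The common value of the expressions in (vi).\<close>

definition flux :: "real \<Rightarrow> 3 \<Rightarrow> int ^ 3 \<Rightarrow> real" where
  "flux \<beta> l n = fP (l + 1) (n + unit_vec (l + 1)) * fM \<beta> (l + 1) (n + unit_vec (l + 1))
       * solA \<beta> (n + unit_vec (l + 1))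
     + fQ \<beta> (l + 1) n * fM \<beta> l n * solA \<beta> n"

lemma flux_outside_octant: "n \<notin> octant \<Longrightarrow> flux \<beta> l n = 0"
proof -
  assume "n \<notin> octant"
  then obtain i where "n $ i < 0"
    by (auto simp: octant_def not_le)
  then show ?thesis
    by (simp add: flux_def fP_mult_supported_zero[OF supported_solA] supported_zero[OF supported_solA])
qed

text \<open>The definition uses the index l + 1; the remaining index gives the same value because
  the difference of the two expressions is the upward relation at n.\<close>

lemma flux_eq:
  assumes "\<beta> > 0" and T: "{j, k, l} = UNIV"
  shows "flux \<beta> l n = fP j (n + unit_vec j) * fM \<beta> j (n + unit_vec j) * solA \<beta> (n + unit_vec j)
     + fQ \<beta> j n * fM \<beta> l n * solA \<beta> n"
proof (cases "j = l + 1")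
  case True
  then show ?thesis by (simp add: flux_def)
next
  case False
  have "j \<in> {l, l + 1, l + 2}" "k \<in> {l, l + 1, l + 2}"
    unfolding triple_succ by simp_all
  then have k: "k = l + 1"
    using False triple_distinct[OF T] by blast
  have "fP j (n + unit_vec j) * fM \<beta> j (n + unit_vec j) * solA \<beta> (n + unit_vec j)
       - fP k (n + unit_vec k) * fM \<beta> k (n + unit_vec k) * solA \<beta> (n + unit_vec k)
     = - ((fP j n - fP k n) * fM \<beta> l n * solA \<beta> n)"
    using solA_rel(1)[OF assms(1), of n] T unfolding rel_up_def by blast
  then show ?thesis
    unfolding flux_def k[symmetric] fQ_eq by (simp add: algebra_simps)
qed

text \<open>The mixed relation \<open>k j l\<close> at n + e_j trades A at n for A at n + e_j +
  e_k.\<close>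

lemma flux_eq':
  assumes "\<beta> > 0" and T: "{j, k, l} = UNIV"
  shows "flux \<beta> l n = fP k (n + unit_vec j + unit_vec k) * fT \<beta> (n + unit_vec j + unit_vec k)
       * solA \<beta> (n + unit_vec j + unit_vec k)
     - fQ \<beta> k (n + unit_vec j) * fM \<beta> j (n + unit_vec j) * solA \<beta> (n + unit_vec j)"
  using solA_rel(2)[OF assms(1) triple_perms(1)[OF T], of "n + unit_vec j"]
  unfolding flux_eq[OF assms] rel_mixed_def by (simp add: algebra_simps)

text \<open>The right-hand side is symmetric in \<open>j\<close> and \<open>l\<close>, hence \<open>flux\<close> is curl-free.\<close>

lemma flux_cross:
  assumes "\<beta> > 0" and T: "{j, k, l} = UNIV"
  shows "flux \<beta> j n + flux \<beta> l (n - unit_vec j)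
     = 2 * (fP k n + 1) * (fP j n + fP l n + \<beta>) * solA \<beta> (n + unit_vec k)"
  using triple_distinct[OF T]
  unfolding flux_eq[OF assms(1) triple_perms(4)[OF T]] flux_eq'[OF assms]
  by (simp add: shift_simps fQ_eq triple_values[OF T, of \<beta> n] algebra_simps)

text \<open>A discrete line integral of the flux down the third axis to the boundary of the octant.
  For a negative third coordinate \<open>nat\<close> gives 0 and the single remaining term
  vanishes.\<close>

definition solB :: "real \<Rightarrow> int ^ 3 \<Rightarrow> real" where
  "solB \<beta> n = - (\<Sum>i\<le>nat (n $ 3). flux \<beta> 3 (n - axis 3 (int i))) / 2"

lemma solB_outside_octant: "n \<notin> octant \<Longrightarrow> solB \<beta> n = 0"
proof -
  assume "n \<notin> octant"
  then obtain j where j: "n $ j < 0"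
    by (auto simp: octant_def not_le)
  have "n - axis 3 (int i) \<notin> octant" for i
  proof
    assume "n - axis 3 (int i) \<in> octant"
    then have "0 \<le> (n - axis 3 (int i)) $ j"
      by (simp add: octant_def)
    then show False
      using j by (simp add: axis_def split: if_splits)
  qed
  then show ?thesis
    by (simp add: solB_def flux_outside_octant)
qed

lemma nabla_solB_3: "nabla 3 (solB \<beta>) n = - flux \<beta> 3 n / 2"
proof (cases "n $ 3 \<le> 0")
  case True
  then have "(n - unit_vec 3) $ 3 < 0"
    by (simp add: unit_vec_nth)
  then have "n - unit_vec 3 \<notin> octant"
    unfolding octant_def by (metis (lifting) mem_Collect_eq not_le)
  then have "solB \<beta> (n - unit_vec 3) = 0"
    by (rule solB_outside_octant)
  moreover have ax: "n - axis 3 0 = n"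
    by (simp add: vec_eq_iff axis_def)
  ultimately show ?thesis
    using True by (simp add: nabla_def solB_def[of _ n] ax)
next
  case False
  define N where "N = nat (n $ 3 - 1)"
  have N: "nat (n $ 3) = Suc N" "nat ((n - unit_vec 3) $ 3) = N"
    using False by (auto simp: N_def unit_vec_nth)
  have ax: "n - axis 3 (int 0) = n" "n - axis 3 (int (Suc i)) = n - unit_vec 3 - axis 3 (int i)" for i
    by (simp_all add: vec_eq_iff axis_def)
  show ?thesis
    unfolding nabla_def solB_def N sum.atMost_Suc_shift ax by (simp add: field_simps)
qed

lemma flux_closed:
  assumes "\<beta> > 0"
  shows "nabla j (flux \<beta> l) n = nabla l (flux \<beta> j) n"
proof (cases "j = l")
  case False
  then obtain k where "{j, l, k} = UNIV"
    by (rule triple_complete)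
  then have T: "{j, k, l} = UNIV"
    by (rule triple_perms(2))
  show ?thesis
    using flux_cross[OF assms T, of n] flux_cross[OF assms triple_perms(3)[OF T], of n]
    by (simp add: nabla_def algebra_simps)
qed simp

text \<open>By closedness both sides change equally in a step along the third axis, and below the
  octant both are zero, so induction on the third coordinate applies.\<close>

lemma nabla_solB:
  assumes "\<beta> > 0"
  shows "nabla l (solB \<beta>) n = - flux \<beta> l n / 2"
proof -
  have "\<forall>n. n $ 3 < int N \<longrightarrow> nabla l (solB \<beta>) n = - flux \<beta> l n / 2" for N
  proof (induction N)
    case 0
    have "nabla l (solB \<beta>) n = - flux \<beta> l n / 2" if n: "n $ 3 < 0" for n
    proof -
      have "(n - unit_vec l) $ 3 < 0"
        using n by (auto simp: unit_vec_nth)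
      with n have "n \<notin> octant" "n - unit_vec l \<notin> octant"
        unfolding octant_def by (metis (lifting) mem_Collect_eq not_le)+
      then show ?thesis
        by (simp add: nabla_def solB_outside_octant flux_outside_octant)
    qed
    then show ?case by simp
  next
    case (Suc N)
    have "nabla l (solB \<beta>) n = - flux \<beta> l n / 2" if n: "n $ 3 < int (Suc N)" for n
    proof -
      have ih: "nabla l (solB \<beta>) (n - unit_vec 3) = - flux \<beta> l (n - unit_vec 3) / 2"
        using Suc n by (simp add: unit_vec_nth)
      have "n - unit_vec 3 - unit_vec l = n - unit_vec l - unit_vec 3"
        by (simp add: algebra_simps)
      then show ?thesis
        using ih nabla_solB_3[of \<beta> n] nabla_solB_3[of \<beta> "n - unit_vec l"]
          flux_closed[OF assms, of 3 l n]
        unfolding nabla_def by (simp add: field_simps)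
    qed
    then show ?case by blast
  qed
  from this[of "nat (n $ 3 + 1)"] show ?thesis by simp
qed

section \<open>The defining equations for the constructed pair\<close>

lemma solution_exists:
  assumes "\<beta> > 0"
  shows "is_solution \<beta> (solA \<beta>) (solB \<beta>)"
proof -
  have L: "opL \<beta> l (solA \<beta>) n = nabla j (nabla k (solB \<beta>)) n" if T: "{j, k, l} = UNIV" for j k l n
  proof -
    note t = triple_distinct[OF T]
    \<comment> \<open>Of the forms of the flux, those are taken that involve only A at n and at n +
      e_l, the values occurring in \<open>opL \<beta> l\<close>.\<close>
    have f1: "flux \<beta> k n = fP l (n + unit_vec l) * fM \<beta> l (n + unit_vec l) * solA \<beta> (n + unit_vec l)
        + fQ \<beta> l n * fM \<beta> k n * solA \<beta> n"
      by (rule flux_eq[OF assms triple_perms(5)[OF T]])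
    have f2: "flux \<beta> k (n - unit_vec j) = fP l (n + unit_vec l) * fT \<beta> (n + unit_vec l)
        * solA \<beta> (n + unit_vec l) - fQ \<beta> l n * fM \<beta> j n * solA \<beta> n"
      using flux_eq'[OF assms triple_perms(2)[OF T], of "n - unit_vec j"] by simp
    have lhs: "opL \<beta> l (solA \<beta>) n = (fP l n + 1) * (fP l n + 2 * \<beta>) * solA \<beta> (n + unit_vec l)
        - (fP l n + \<beta>) * (fP l n + 1 - \<beta>) * solA \<beta> n"
      by (simp add: opL_def f_plus_def f_minus_def fP_def)
    have "nabla j (nabla k (solB \<beta>)) n = - (flux \<beta> k n - flux \<beta> k (n - unit_vec j)) / 2"
      unfolding nabla_def[of j] nabla_solB[OF assms] by (simp add: field_simps)
    also have "\<dots> = opL \<beta> l (solA \<beta>) n"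
      unfolding f1 f2 lhs fQ_eq using t
      by (simp add: shift_simps triple_values[OF T, of \<beta> n] field_simps)
    finally show ?thesis by simp
  qed
  \<comment> \<open>Moving from n - e_k down by e_j and then by e_l adds two fluxes, whose sum
    \<open>flux_cross\<close> evaluates.\<close>
  have R: "solB \<beta> (n - unit_vec k) - solB \<beta> (n - unit_vec l - unit_vec j - unit_vec k)
      = - fP k n * (fP j n + fP l n + \<beta>) * solA \<beta> n" if T: "{j, k, l} = UNIV" for j k l n
  proof -
    define m where "m = n - unit_vec k"
    have m: "m + unit_vec k = n" "n - unit_vec l - unit_vec j - unit_vec k = m - unit_vec j - unit_vec l"
      by (simp_all add: m_def algebra_simps)
    have "solB \<beta> m - solB \<beta> (m - unit_vec j - unit_vec l)
        = nabla j (solB \<beta>) m + nabla l (solB \<beta>) (m - unit_vec j)"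
      by (simp add: nabla_def)
    also have "\<dots> = - (flux \<beta> j m + flux \<beta> l (m - unit_vec j)) / 2"
      by (simp add: nabla_solB[OF assms] field_simps)
    also have "\<dots> = - fP k n * (fP j n + fP l n + \<beta>) * solA \<beta> n"
      unfolding flux_cross[OF assms T] m(1) using triple_distinct[OF T]
      by (simp add: m_def shift_simps)
    finally show ?thesis
      unfolding m(2) m_def[symmetric] .
  qed
  \<comment> \<open>The instance of \<open>R\<close> with l in the middle, minus those with j and
    with k there.\<close>
  have B: "(2 * of_int (n $ j) * of_int (n $ k) + \<beta> * of_int (n $ j) + \<beta> * of_int (n $ k)
            - \<beta> * of_int (n $ l)) * solA \<beta> n
          = solB \<beta> (n - unit_vec l) + solB \<beta> (n - unit_vec l - unit_vec j - unit_vec k)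
            - solB \<beta> (n - unit_vec j) - solB \<beta> (n - unit_vec k)" if T: "{j, k, l} = UNIV" for j k l n
  proof -
    have "n - unit_vec k - unit_vec j - unit_vec l = n - unit_vec l - unit_vec j - unit_vec k"
      "n - unit_vec l - unit_vec k - unit_vec j = n - unit_vec l - unit_vec j - unit_vec k"
      by (simp_all add: algebra_simps)
    then show ?thesis
      using R[OF T, of n] R[OF triple_perms(1)[OF T], of n] R[OF triple_perms(2)[OF T], of n]
      unfolding fP_def[symmetric] by (simp add: algebra_simps)
  qed
  show ?thesis
    unfolding is_solution_def supported_on_octant_def
    using L B solB_outside_octant supported_solA solA_zero by (simp add: supported_on_octant_def)
qed

section \<open>Uniqueness by levels\<close>

lemma solution_B_step:
  assumes "is_solution \<beta> A B" and T: "{j, k, l} = UNIV"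
  shows "B n = B (n - unit_vec j - unit_vec l)
     - (fP k n + 1) * (fP j n + fP l n + \<beta>) * A (n + unit_vec k)"
proof -
  define m where "m = n + unit_vec k"
  have eqs: "\<And>j k l. {j, k, l} = UNIV \<Longrightarrow> (2 * fP j m * fP k m + \<beta> * fP j m + \<beta> * fP k m
            - \<beta> * fP l m) * A m
          = B (m - unit_vec l) + B (m - unit_vec l - unit_vec j - unit_vec k)
            - B (m - unit_vec j) - B (m - unit_vec k)"
    using assms(1) unfolding is_solution_def fP_def by blast
  have eq: "m - unit_vec l - unit_vec j - unit_vec k = n - unit_vec j - unit_vec l"
      "m - unit_vec j - unit_vec k - unit_vec l = n - unit_vec j - unit_vec l"
      "m - unit_vec k = n"
    by (simp_all add: m_def algebra_simps)
  have "fP k m = fP k n + 1" "fP j m = fP j n" "fP l m = fP l n"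
    using triple_distinct[OF T] by (simp_all add: m_def shift_simps)
  \<comment> \<open>The equations singling out l and j are added: B at m - e_j and at m - e_l
    cancels, and twice the wanted difference is left.\<close>
  then show ?thesis
    using eqs[OF T] eqs[OF triple_perms(4)[OF T]] unfolding eq m_def[symmetric] by algebra
qed

text \<open>\<open>solution_B_step\<close> removes the only B-value at the level of n. What remains
  is a recursion for A at n + e_l from A at n and from B at lower levels.\<close>

lemma solution_A_step:
  assumes "is_solution \<beta> A B" and T: "{j, k, l} = UNIV"
  shows "(fP l n + 1) * (fT \<beta> n + 1) * A (n + unit_vec l)
     = f_minus \<beta> (n $ l) * A n + 2 * B (n - unit_vec j - unit_vec k)
       - B (n - unit_vec j) - B (n - unit_vec k)"
proof -
  have "f_plus \<beta> (n $ l + 1) * A (n + unit_vec l) - f_minus \<beta> (n $ l) * A n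
      = B n - B (n - unit_vec k) - (B (n - unit_vec j) - B (n - unit_vec j - unit_vec k))"
    using assms unfolding is_solution_def opL_def nabla_def by blast
  moreover have "f_plus \<beta> (n $ l + 1) = (fP l n + 1) * (fP l n + 2 * \<beta>)"
    by (simp add: f_plus_def fP_def)
  ultimately show ?thesis
    using solution_B_step[OF assms(1) triple_perms(2)[OF T], of n]
    unfolding triple_values[OF T, of \<beta> n] by algebra
qed

text \<open>A runs one level ahead of B: A at level N + 1 uses A at level N and B below level N,
  after which B at level N follows from B two levels lower and A at level N + 1.\<close>

lemma solution_unique:
  assumes b: "\<beta> > 0" and sol: "is_solution \<beta> A B" "is_solution \<beta> A' B'"
  shows "A = A'" "B = B'"
proof -
  have supp: "supported_on_octant A" "supported_on_octant B" "supported_on_octant A'"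
      "supported_on_octant B'" and zero: "A 0 = 1" "A' 0 = 1"
    using sol by (auto simp: is_solution_def)
  have levels: "(\<forall>n. coord_sum n \<le> int N \<longrightarrow> A n = A' n) \<and> (\<forall>n. coord_sum n < int N \<longrightarrow> B n = B' n)" for N
  proof (induction N)
    case 0
    have "A n = A' n" if "coord_sum n \<le> 0" for n
    proof (cases "n \<in> octant")
      case True
      then have "n = 0"
        using that octant_coord_sum_nonneg[of n] octant_coord_sum_zero[of n] by linarith
      then show ?thesis
        using zero by simp
    qed (use supp in \<open>simp add: supported_on_octant_def\<close>)
    moreover have "B n = B' n" if "coord_sum n < 0" for n
    proof -
      have "n \<notin> octant"
        using that octant_coord_sum_nonneg[of n] by auto
      then show ?thesis
        using supp by (simp add: supported_on_octant_def)
    qed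
    ultimately show ?case by simp
  next
    case (Suc N)
    have ihA: "A n = A' n" if "coord_sum n \<le> int N" for n
      using Suc that by blast
    have ihB: "B n = B' n" if "coord_sum n < int N" for n
      using Suc that by blast
    have A: "A m = A' m" if m: "coord_sum m \<le> int (Suc N)" for m
    proof (cases "m \<in> octant \<and> m \<noteq> 0")
      case True
      then obtain l where l: "0 < m $ l"
        using octant_coord_pos by blast
      define n where "n = m - unit_vec l"
      have eq: "n + unit_vec l = m"
        by (simp add: n_def)
      have n: "n \<in> octant"
        using True l by (auto simp: n_def octant_def unit_vec_nth)
      have lev: "coord_sum n \<le> int N"
        using m by (simp add: n_def)
      have pos: "(fP l n + 1) * (fT \<beta> n + 1) \<noteq> 0"
        using fT_succ_pos[OF b octant_coord_sum_nonneg[OF n]] l by (simp add: n_def fP_def unit_vec_nth)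
      have T: "{l + 1, l + 2, l} = UNIV"
        using triple_succ[of l] by (rule triple_perms(4))
      show ?thesis
        using solution_A_step[OF sol(1) T, of n] solution_A_step[OF sol(2) T, of n]
        using pos lev mult_left_cancel[OF pos, of "A m" "A' m"] by (simp add: eq ihA[of n] ihB)
    next
      case False
      then show ?thesis
        using supp zero by (auto simp: supported_on_octant_def)
    qed
    have "B n = B' n" if "coord_sum n < int (Suc N)" for n
      using solution_B_step[OF sol(1) triple_succ[of 1], of n] that
        solution_B_step[OF sol(2) triple_succ[of 1], of n] by (simp add: A ihB)
    with A show ?case by blast
  qed
  show "A = A'"
  proof
    show "A n = A' n" for n
      using levels[of "nat (coord_sum n + 1)"] by simp
  qed
  show "B = B'"
  proof
    show "B n = B' n" for n
      using levels[of "nat (coord_sum n + 1)"] by simp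
  qed
qed

section \<open>Symmetry and the operators H\<close>

text \<open>The system treats the three indices alike. Reading coordinates through \<pi> moves unit
  vectors by the inverse permutation, hence \<open>\<rho>\<close> in the proof.\<close>

lemma is_solution_permute:
  assumes "is_solution \<beta> A B" "bij \<pi>"
  shows "is_solution \<beta> (\<lambda>n. A (\<chi> i. n $ \<pi> i)) (\<lambda>n. B (\<chi> i. n $ \<pi> i))"
proof -
  define \<sigma> :: "int ^ 3 \<Rightarrow> int ^ 3" where "\<sigma> n = (\<chi> i. n $ \<pi> i)" for n
  define \<rho> where "\<rho> = inv \<pi>"
  have \<pi>\<rho>: "\<pi> (\<rho> j) = j" "\<rho> (\<pi> j) = j" for j
    using assms(2) by (simp_all add: \<rho>_def bij_is_surj surj_f_inv_f bij_is_inj)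
  have unit: "\<sigma> (unit_vec j) = unit_vec (\<rho> j)" for j
    using \<pi>\<rho> by (auto simp: \<sigma>_def vec_eq_iff axis_def)
  have add: "\<sigma> (m + n) = \<sigma> m + \<sigma> n" "\<sigma> (m - n) = \<sigma> m - \<sigma> n" for m n
    by (simp_all add: \<sigma>_def vec_eq_iff)
  have nth: "\<sigma> n $ \<rho> j = n $ j" for n j
    by (simp add: \<sigma>_def \<pi>\<rho>)
  have oct: "\<sigma> n \<in> octant \<longleftrightarrow> n \<in> octant" for n
    unfolding octant_def mem_Collect_eq by (metis \<sigma>_def nth \<pi>\<rho>)
  have zero: "\<sigma> 0 = 0"
    by (simp add: \<sigma>_def vec_eq_iff)
  have triple: "{\<rho> j, \<rho> k, \<rho> l} = UNIV" if "{j, k, l} = UNIV" for j k l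
  proof -
    have "\<rho> ` {j, k, l} = UNIV"
      unfolding that using \<pi>\<rho> by (metis surjI)
    then show ?thesis by simp
  qed
  have eqs: "opL \<beta> l A n = nabla j (nabla k B) n"
    "(2 * of_int (n $ j) * of_int (n $ k) + \<beta> * of_int (n $ j) + \<beta> * of_int (n $ k)
            - \<beta> * of_int (n $ l)) * A n
          = B (n - unit_vec l) + B (n - unit_vec l - unit_vec j - unit_vec k)
            - B (n - unit_vec j) - B (n - unit_vec k)"
    if "{j, k, l} = UNIV" for j k l n
    using assms(1) that unfolding is_solution_def by blast+
  have "is_solution \<beta> (A \<circ> \<sigma>) (B \<circ> \<sigma>)"
    unfolding is_solution_def
  proof (intro conjI allI impI)
    fix n and j k l :: 3
    assume T: "{j, k, l} = UNIV"
    show "opL \<beta> l (A \<circ> \<sigma>) n = nabla j (nabla k (B \<circ> \<sigma>)) n"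
      using eqs(1)[OF triple[OF T], of "\<sigma> n"] by (simp add: opL_def nabla_def unit add nth)
    show "(2 * of_int (n $ j) * of_int (n $ k) + \<beta> * of_int (n $ j) + \<beta> * of_int (n $ k)
            - \<beta> * of_int (n $ l)) * (A \<circ> \<sigma>) n
          = (B \<circ> \<sigma>) (n - unit_vec l) + (B \<circ> \<sigma>) (n - unit_vec l - unit_vec j - unit_vec k)
            - (B \<circ> \<sigma>) (n - unit_vec j) - (B \<circ> \<sigma>) (n - unit_vec k)"
      using eqs(2)[OF triple[OF T], of "\<sigma> n"] by (simp add: unit add nth)
  qed (use assms(1) in \<open>auto simp: is_solution_def supported_on_octant_def oct zero\<close>)
  then show ?thesis
    by (simp add: comp_def \<sigma>_def)
qed

lemma solution_symmetric:
  assumes "\<beta> > 0" "is_solution \<beta> A B"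
  shows "symmetric_fun A" "symmetric_fun B"
proof -
  have "(\<lambda>n. A (\<chi> i. n $ \<pi> i)) = A" "(\<lambda>n. B (\<chi> i. n $ \<pi> i)) = B" if "bij \<pi>" for \<pi> :: "3 \<Rightarrow> 3"
    using solution_unique[OF assms(1) is_solution_permute[OF assms(2) that] assms(2)] by simp_all
  then show "symmetric_fun A" "symmetric_fun B"
    unfolding symmetric_fun_def by (auto dest: fun_cong)
qed

text \<open>For distinct indices both sides are the triple difference of B in all three directions,
  and difference operators commute.\<close>

lemma solution_opH:
  assumes "is_solution \<beta> A B"
  shows "opH \<beta> j A n = opH \<beta> k A n"
proof (cases "j = k")
  case False
  then obtain l where T: "{j, k, l} = UNIV"
    by (rule triple_complete)
  have L: "opL \<beta> k A n = nabla j (nabla l B) n" "opL \<beta> j A n = nabla k (nabla l B) n" for n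
    using assms triple_perms[OF T] unfolding is_solution_def by blast+
  have comm: "n - unit_vec j - unit_vec k = n - unit_vec k - unit_vec j"
    by (simp add: algebra_simps)
  show ?thesis
    unfolding opH_def nabla_def[of j "opL _ _ _"] nabla_def[of k "opL _ _ _"] L
    by (simp add: nabla_def comm)
qed simp

section \<open>Values on a coordinate face\<close>

lemma vector_add_unit_vec:
  "vector [x, y, z] + unit_vec 1 = (vector [x + 1, y, z] :: int ^ 3)"
  "vector [x, y, z] + unit_vec 2 = (vector [x, y + 1, z] :: int ^ 3)"
  by (simp_all add: vec_eq_iff forall_3 unit_vec_nth)

text \<open>On the face the mixed relation with middle index 3 loses its downward term. This leaves
  a two-term recursion whose factors are those of the Pochhammer symbols.\<close>

lemma solA_face:
  assumes b: "\<beta> > 0"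
  shows "solA \<beta> (vector [int n1, int n2, 0])
     = pochhammer \<beta> n1 * pochhammer \<beta> n2 * pochhammer (1 - \<beta>) (n1 + n2)
       / (pochhammer 1 n1 * pochhammer 1 n2 * pochhammer (3 * \<beta>) (n1 + n2))"
proof -
  have T: "{1, 3, 2} = (UNIV :: 3 set)" "{2, 3, 1} = (UNIV :: 3 set)"
    by (auto simp: UNIV_3)
  have step: "solA \<beta> (n + unit_vec j)
      = (fP j n + \<beta>) * fM \<beta> 3 n * solA \<beta> n / ((fP j n + 1) * (fT \<beta> n + 1))"
    if "{j, 3, l} = UNIV" "n $ 3 = 0" "n \<in> octant" for j l n
  proof -
    have "solA \<beta> (n - unit_vec 3) = 0"
      using that by (intro supported_zero[OF supported_solA, of _ 3]) (simp add: unit_vec_nth)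
    moreover have "fP j n + 1 > 0" "fT \<beta> n + 1 > 0"
      using that fT_succ_pos[OF b octant_coord_sum_nonneg[of n]] by (auto simp: fP_def octant_def add_nonneg_pos)
    moreover have "(fP j n + 1) * (fT \<beta> n + 1) * solA \<beta> (n + unit_vec j)
        = (fP j n + \<beta>) * fM \<beta> 3 n * solA \<beta> n"
      using solA_rel(2)[OF b that(1), of n] that(2) calculation(1)
      by (simp add: rel_mixed_def shift_simps fQ_eq fP_def[of 3])
    ultimately show ?thesis
      by (simp add: eq_divide_eq mult_ac)
  qed
  have oct: "vector [int n1, int n2, 0] \<in> octant" for n1 n2
    by (simp add: octant_def forall_3)
  have vals: "fM \<beta> 3 (vector [x, y, 0]) = of_int x + of_int y + 1 - \<beta>"
    "fT \<beta> (vector [x, y, 0]) = of_int x + of_int y - 1 + 3 * \<beta>"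
    "fP 1 (vector [x, y, 0]) = of_int x" "fP 2 (vector [x, y, 0]) = of_int y" for x y
    by (simp_all add: fM_def fT_def fP_def coord_sum_def sum_3)
  have step1: "solA \<beta> (vector [int (Suc x), int y, 0]) = (\<beta> + real x) * (1 - \<beta> + real (x + y))
      * solA \<beta> (vector [int x, int y, 0]) / ((1 + real x) * (3 * \<beta> + real (x + y)))" for x y
    using step[OF T(1) _ oct, of x y] unfolding vector_add_unit_vec vals by (simp add: algebra_simps)
  have step2: "solA \<beta> (vector [int x, int (Suc y), 0]) = (\<beta> + real y) * (1 - \<beta> + real (x + y))
      * solA \<beta> (vector [int x, int y, 0]) / ((1 + real y) * (3 * \<beta> + real (x + y)))" for x y
    using step[OF T(2) _ oct, of x y] unfolding vector_add_unit_vec vals by (simp add: algebra_simps)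
  have zero: "vector [int 0, int 0, 0] = (0 :: int ^ 3)"
    by (simp add: vec_eq_iff forall_3)
  show ?thesis
  proof (induction n1)
    case 0
    show ?case
    proof (induction n2)
      case 0
      show ?case
        unfolding zero by (simp add: solA_zero)
    next
      case (Suc y)
      show ?case
        unfolding step2 Suc by (simp add: pochhammer_Suc mult_ac)
    qed
  next
    case (Suc x)
    show ?case
      unfolding step1 Suc by (simp add: pochhammer_Suc mult_ac)
  qed
qed

text \<open>With k = 1 in \<open>solution_B_step\<close>, the earlier value of B has a negative
  third coordinate and vanishes, so B at n is a multiple of A at n + e_1.\<close>

lemma solB_face:
  assumes b: "\<beta> > 0"
  shows "solB \<beta> (vector [int n1, int n2, 0])
     = - (pochhammer \<beta> (n1 + 1) * pochhammer \<beta> (n2 + 1) * pochhammer (1 - \<beta>) (n1 + n2 + 1)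
       / (pochhammer 1 n1 * pochhammer 1 n2 * pochhammer (3 * \<beta>) (n1 + n2 + 1)))"
proof -
  define n :: "int ^ 3" where "n = vector [int n1, int n2, 0]"
  have T: "{3, 1, 2} = (UNIV :: 3 set)"
    by (auto simp: UNIV_3)
  have "(n - unit_vec 3 - unit_vec 2) $ 3 < 0"
    by (simp add: n_def unit_vec_nth)
  then have "n - unit_vec 3 - unit_vec 2 \<notin> octant"
    unfolding octant_def by (metis (lifting) mem_Collect_eq not_le)
  then have "solB \<beta> (n - unit_vec 3 - unit_vec 2) = 0"
    by (rule solB_outside_octant)
  moreover have "n + unit_vec 1 = vector [int (Suc n1), int n2, 0]"
    unfolding n_def vector_add_unit_vec by (simp add: add_ac)
  ultimately have "solB \<beta> n = - ((real n1 + 1) * (real n2 + \<beta>)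
      * solA \<beta> (vector [int (Suc n1), int n2, 0]))"
    using solution_B_step[OF solution_exists[OF b] T, of n] by (simp add: fP_def n_def)
  \<comment> \<open>With n1 for x and n2 for y, \<open>x + 1\<close> cancels the last factor of
    \<open>pochhammer 1 (Suc n1)\<close>, and \<open>y + \<beta>\<close> completes
    \<open>pochhammer \<beta> (Suc n2)\<close>.\<close>
  moreover have cancel: "(x + 1) * (y + \<beta>) * (p * q * r / (u * (1 + x) * v * w)) = p * (q * (\<beta> + y)) * r / (u * v * w)"
    if "x \<ge> 0" for x y p q r u v w :: real
    using that by (simp add: divide_simps) (simp add: algebra_simps)
  moreover have "pochhammer (1 :: real) (Suc n1) = pochhammer 1 n1 * (1 + real n1)"
    "pochhammer \<beta> (Suc n2) = pochhammer \<beta> n2 * (\<beta> + real n2)"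
    by (rule pochhammer_Suc)+
  ultimately show ?thesis
    unfolding solA_face[OF b] n_def Suc_eq_plus1[symmetric] add_Suc
    by (simp only: cancel of_nat_0_le_iff)
qed

section \<open>Equality of the six functions X\<close>

text \<open>The mixed relation at n times \<open>fM \<beta> j n - 1\<close> matches the shifted
  terms; the constants in the definitions make the coefficients of A at n agree as well.\<close>

lemma X_plus_eq_X_minus:
  assumes b: "\<beta> > 0" and T: "{j, k, l} = UNIV"
  shows "X_plus \<beta> (solA \<beta>) j k l n = X_minus \<beta> (solA \<beta>) k j l n"
proof -
  note t = triple_distinct[OF T]
  have "(fP j n + 1) * (fT \<beta> n + 1) * solA \<beta> (n + unit_vec j)
      - (fQ \<beta> k n - 1) * (fM \<beta> l n - 1) * solA \<beta> (n - unit_vec k)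
      = (fP k n + fQ \<beta> j n) * fM \<beta> k n * solA \<beta> n"
    using solA_rel(2)[OF b T, of n] t unfolding rel_mixed_def by (simp add: shift_simps)
  moreover have "X_plus \<beta> (solA \<beta>) j k l n
      = (fP j n + 1) * (fM \<beta> j n - 1) * (fT \<beta> n + 1) * solA \<beta> (n + unit_vec j)
        + (fP j n + 2 * \<beta> - 1 / 2) * fM \<beta> k n * fM \<beta> l n * solA \<beta> n"
    "X_minus \<beta> (solA \<beta>) k j l n
      = (fQ \<beta> k n - 1) * (fM \<beta> j n - 1) * (fM \<beta> l n - 1) * solA \<beta> (n - unit_vec k)
        + (fP k n - \<beta> + 1 / 2) * fM \<beta> k n * fT \<beta> n * solA \<beta> n"
    using t by (simp_all add: X_plus_def X_minus_def shift_simps)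
  ultimately show ?thesis
    unfolding fQ_eq triple_values[OF T, of \<beta> n] by algebra
qed

text \<open>Two plus functions agree because both equal the minus function of the third index
  (\<open>flip\<close>); passing from j to l and back then gives plus equal to minus for the same
  index (\<open>diag\<close>).\<close>

lemma X_all_equal:
  assumes b: "\<beta> > 0" and T: "{j, k, l} = UNIV" and T': "{j', k', l'} = UNIV"
  shows "X_plus \<beta> (solA \<beta>) j k l n = X_plus \<beta> (solA \<beta>) j' k' l' n"
    "X_minus \<beta> (solA \<beta>) j k l n = X_minus \<beta> (solA \<beta>) j' k' l' n"
    "X_plus \<beta> (solA \<beta>) j k l n = X_minus \<beta> (solA \<beta>) j' k' l' n"
proof -
  define X Y where "X = (\<lambda>j k l. X_plus \<beta> (solA \<beta>) j k l n)" and "Y = (\<lambda>j k l. X_minus \<beta> (solA \<beta>) j k l n)"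
  have swap: "X j l k = X j k l" "Y j l k = Y j k l" for j k l
    by (simp_all add: X_def Y_def X_plus_def X_minus_def mult_ac)
  have XY: "X j k l = Y k j l" if "{j, k, l} = UNIV" for j k l
    unfolding X_def Y_def by (rule X_plus_eq_X_minus[OF b that])
  have flip: "X j k l = X l k j" if "{j, k, l} = UNIV" for j k l
    using XY[OF that] XY[OF triple_perms(3)[OF that]] swap(2)[of k j l] by simp
  have diag: "X j k l = Y j k l" if "{j, k, l} = UNIV" for j k l
    using flip[OF that] XY[OF triple_perms(5)[OF that]] swap(1)[of l j k] swap(2)[of j l k] by simp
  have "j' \<in> {j, k, l}" "k' \<in> {j, k, l}" "l' \<in> {j, k, l}"
    unfolding T by simp_all
  then have "(j', k', l') \<in> {(j, k, l), (j, l, k), (k, j, l), (k, l, j), (l, j, k), (l, k, j)}"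
    using triple_distinct[OF T'] by auto
  moreover have "X k l j = X j k l" "X l k j = X j k l"
    using flip[OF T] flip[OF triple_perms(2)[OF T]] by (simp_all add: swap)
  ultimately have X': "X j' k' l' = X j k l"
    using swap(1)[of j k l] swap(1)[of k j l] swap(1)[of l j k] by auto
  with diag[OF T] diag[OF T']
  show "X_plus \<beta> (solA \<beta>) j k l n = X_plus \<beta> (solA \<beta>) j' k' l' n"
    "X_minus \<beta> (solA \<beta>) j k l n = X_minus \<beta> (solA \<beta>) j' k' l' n"
    "X_plus \<beta> (solA \<beta>) j k l n = X_minus \<beta> (solA \<beta>) j' k' l' n"
    by (simp_all add: X_def Y_def)
qed

section \<open>Vanishing and finite support for natural \<beta>\<close>

text \<open>For natural \<beta> the values of \<open>fM\<close> are integers. Going up by levels,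
  every term in the recursion for A at m vanishes, by induction, by the support or by a zero
  coefficient.\<close>

lemma solA_vanishes:
  assumes b: "b > 0" and M: "1 \<le> fM (real b) l m"
  shows "solA (real b) m = 0"
proof -
  have b': "real b > 0" using b by simp
  have "\<forall>m. coord_sum m < int N \<longrightarrow> 1 \<le> fM (real b) l m \<longrightarrow> solA (real b) m = 0" for N
  proof (induction N)
    case 0
    show ?case
      using supported_solA octant_coord_sum_nonneg unfolding supported_on_octant_def
      by (metis not_le of_nat_0)
  next
    case (Suc N)
    have "solA (real b) m = 0" if lev: "coord_sum m < int (Suc N)" and M: "1 \<le> fM (real b) l m" for m
    proof (cases "m \<in> octant")
      case True
      have "m \<noteq> 0"
        using M b by (auto simp: fM_def)
      then have "0 < coord_sum m"
        using True octant_coord_sum_nonneg[of m] octant_coord_sum_zero[of m] by linarith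
      then have T0: "fT (real b) m \<noteq> 0"
        using b by (simp add: fT_def)
      show ?thesis
      proof (cases "m $ l = 0")
        \<comment> \<open>A step down along l would leave the octant. In another direction j, with l
          as middle index, one neighbour lies outside the octant and the other carries the factor
          \<open>fM\<close> for l.\<close>
        case l: True
        obtain j where j: "0 < m $ j"
          using octant_coord_pos[OF True \<open>m \<noteq> 0\<close>] by blast
        then have "j \<noteq> l"
          using l by auto
        then obtain k where T: "{j, l, k} = UNIV"
          by (rule triple_complete)
        have "solA (real b) (m - unit_vec j - unit_vec l) = 0"
          by (rule supported_zero[OF supported_solA, of _ l]) (use l j in \<open>auto simp: unit_vec_nth\<close>)
        moreover have "fM (real b) l (m - unit_vec j) * solA (real b) (m - unit_vec j) = 0"
        proof (cases "fM (real b) l (m - unit_vec j) = 0")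
          case False
          \<comment> \<open>Lowering m by e_j reduces \<open>fM\<close> for l from
            \<open>c + 1\<close> to \<open>c\<close>, a nonnegative integer: either 0, or at least 1
            so that the induction hypothesis applies.\<close>
          define c where "c = coord_sum m - 2 * m $ l - int b"
          have c: "fM (real b) l m = of_int (c + 1)"
            by (simp add: c_def fM_def)
          have "fM (real b) l (m - unit_vec j) = of_int c"
            using j l unfolding shift_simps c by auto
          with False M c have "1 \<le> fM (real b) l (m - unit_vec j)"
            by simp
          then show ?thesis
            using Suc lev by simp
        qed simp
        ultimately have "fP j m * fT (real b) m * solA (real b) m = 0"
          using solA_rel(2)[OF b' T, of "m - unit_vec j"] by (simp add: rel_mixed_def)
        then show ?thesis
          using j T0 by (simp add: fP_def)
      next
        case False
        \<comment> \<open>Subtracting e_l raises \<open>fM\<close> for l by 1 and subtracting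
          e_(l+1) lowers it by 1, so both points stay in the range.\<close>
        have "1 \<le> fM (real b) l (m - unit_vec l)" "1 \<le> fM (real b) l (m - unit_vec l - unit_vec (l + 1))"
          using M by (simp_all add: shift_simps)
        then have "solA (real b) (m - unit_vec l) = 0" "solA (real b) (m - unit_vec l - unit_vec (l + 1)) = 0"
          using Suc lev by simp_all
        then have "fP l m * fT (real b) m * solA (real b) m = 0"
          using solA_rel(2)[OF b' triple_succ[of l], of "m - unit_vec l"] by (simp add: rel_mixed_def)
        then show ?thesis
          using False T0 by (simp add: fP_def)
      qed
    qed (use supported_solA in \<open>simp add: supported_on_octant_def\<close>)
    then show ?case by blast
  qed
  from this[of "nat (coord_sum m + 1)"] M show ?thesis by simp
qed

text \<open>A step by e_l + e_(l+1) leaves \<open>fM\<close> for l unchanged, and the correction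
  term is A at m + e_(l+2), where \<open>fM\<close> is larger by 1. Hence the threshold 0 for B
  against 1 for A.\<close>

lemma solB_vanishes:
  assumes b: "b > 0" and M: "0 \<le> fM (real b) l m"
  shows "solB (real b) m = 0"
proof -
  have b': "real b > 0" using b by simp
  have "\<forall>m. coord_sum m < int N \<longrightarrow> 0 \<le> fM (real b) l m \<longrightarrow> solB (real b) m = 0" for N
  proof (induction N)
    case 0
    show ?case
      using solB_outside_octant octant_coord_sum_nonneg by (metis not_le of_nat_0)
  next
    case (Suc N)
    have "solB (real b) m = 0" if lev: "coord_sum m < int (Suc N)" and M: "0 \<le> fM (real b) l m" for m
    proof -
      have T: "{l + 1, l + 2, l} = UNIV"
        using triple_succ[of l] by (rule triple_perms(4))
      have "solA (real b) (m + unit_vec (l + 2)) = 0"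
        by (rule solA_vanishes[OF b, of l]) (use M in \<open>simp add: shift_simps\<close>)
      moreover have "solB (real b) (m - unit_vec (l + 1) - unit_vec l) = 0"
        using Suc lev M by (simp add: shift_simps)
      ultimately show ?thesis
        using solution_B_step[OF solution_exists[OF b'] T, of m] by simp
    qed
    then show ?case by blast
  qed
  from this[of "nat (coord_sum m + 1)"] M show ?thesis by simp
qed

lemma finite_octant_bounded: "finite {n \<in> octant. \<forall>i. n $ i \<le> b}"
proof (rule finite_subset)
  show "{n \<in> octant. \<forall>i. n $ i \<le> b} \<subseteq> (\<lambda>(x, y, z). vector [x, y, z]) ` ({0..b} \<times> {0..b} \<times> {0..b})"
  proof
    fix n :: "int ^ 3"
    assume "n \<in> {n \<in> octant. \<forall>i. n $ i \<le> b}"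
    moreover have "n = (\<lambda>(x, y, z). vector [x, y, z]) (n $ 1, n $ 2, n $ 3)"
      by (simp add: vec_eq_iff forall_3)
    ultimately show "n \<in> (\<lambda>(x, y, z). vector [x, y, z]) ` ({0..b} \<times> {0..b} \<times> {0..b})"
      unfolding octant_def by (intro image_eqI[where x = "(n $ 1, n $ 2, n $ 3)"]) auto
  qed
qed simp

text \<open>The three values of \<open>fM\<close> add up to the level plus 3 - 3 b. Each is below 1
  on the support, so the level, and with it every coordinate, stays below 3 b.\<close>

lemma solution_finite_support:
  assumes b: "b > 0"
  shows "finite {n. solA (real b) n \<noteq> 0 \<or> solB (real b) n \<noteq> 0}"
proof (rule finite_subset[OF _ finite_octant_bounded[of "3 * int b"]], intro subsetI CollectI conjI allI)
  fix n and i :: 3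
  assume "n \<in> {n. solA (real b) n \<noteq> 0 \<or> solB (real b) n \<noteq> 0}"
  then have n: "solA (real b) n \<noteq> 0 \<or> solB (real b) n \<noteq> 0" by simp
  show oct: "n \<in> octant"
    using n supported_solA solB_outside_octant by (auto simp: supported_on_octant_def)
  have "fM (real b) l n < 1" for l
    using n solA_vanishes[OF b, of l n] solB_vanishes[OF b, of l n] by fastforce
  from this[of 1] this[of 2] this[of 3] have "of_int (coord_sum n) < 3 * real b"
    by (simp add: fM_def coord_sum_def sum_3)
  moreover have "n $ i \<le> coord_sum n"
    using oct unfolding coord_sum_def octant_def by (intro member_le_sum) auto
  ultimately show "n $ i \<le> 3 * int b"
    by linarith
qed

section \<open>Reduction of every claim to the constructed solution\<close>

theorem theorem3p2:
  fixes \<beta> :: real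
  assumes "\<beta> > 0"
  shows "(\<exists>!AB. is_solution \<beta> (fst AB) (snd AB)) \<and>
    (\<forall>A B. is_solution \<beta> A B \<longrightarrow>
      \<comment> \<open>(i)\<close>
      (symmetric_fun A \<and> symmetric_fun B) \<and>
      \<comment> \<open>(ii)\<close>
      (\<forall>n j k. opH \<beta> j A n = opH \<beta> k A n) \<and>
      \<comment> \<open>(iii)\<close>
      (\<forall>n1 n2 :: nat.
         A (vector [int n1, int n2, 0])
           = pochhammer \<beta> n1 * pochhammer \<beta> n2 * pochhammer (1 - \<beta>) (n1 + n2)
             / (pochhammer 1 n1 * pochhammer 1 n2 * pochhammer (3 * \<beta>) (n1 + n2)) \<and>
         B (vector [int n1, int n2, 0])
           = - (pochhammer \<beta> (n1 + 1) * pochhammer \<beta> (n2 + 1) * pochhammer (1 - \<beta>) (n1 + n2 + 1)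
             / (pochhammer 1 n1 * pochhammer 1 n2 * pochhammer (3 * \<beta>) (n1 + n2 + 1)))) \<and>
      \<comment> \<open>(iv)\<close>
      (\<forall>n j k l. {j, k, l} = UNIV \<longrightarrow>
         (\<lambda>m. fP j m * fM \<beta> j m * A m) (n + unit_vec j)
           - (\<lambda>m. fP k m * fM \<beta> k m * A m) (n + unit_vec k)
           = - ((fP j n - fP k n) * fM \<beta> l n * A n) \<and>
         (\<lambda>m. fP j m * fT \<beta> m * A m) (n + unit_vec j)
           - (\<lambda>m. fQ \<beta> k m * fM \<beta> l m * A m) (n - unit_vec k)
           = (fP k n + fQ \<beta> j n) * fM \<beta> k n * A n \<and>
         (\<lambda>m. fQ \<beta> j m * fM \<beta> k m * A m) (n - unit_vec j)
           - (\<lambda>m. fQ \<beta> k m * fM \<beta> j m * A m) (n - unit_vec k)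
           = (fP j n - fP k n) * fT \<beta> n * A n) \<and>
      \<comment> \<open>(v)\<close>
      (\<forall>n\<in>octant. \<forall>j k l j' k' l'. {j, k, l} = UNIV \<and> {j', k', l'} = UNIV \<longrightarrow>
         X_plus \<beta> A j k l n = X_plus \<beta> A j' k' l' n \<and>
         X_minus \<beta> A j k l n = X_minus \<beta> A j' k' l' n \<and>
         X_plus \<beta> A j k l n = X_minus \<beta> A j' k' l' n) \<and>
      \<comment> \<open>(vi)\<close>
      (\<forall>n j k l. {j, k, l} = UNIV \<longrightarrow>
         - 2 * nabla l B n
           = (\<lambda>m. fP j m * fM \<beta> j m * A m) (n + unit_vec j) + fQ \<beta> j n * fM \<beta> l n * A n \<and>
         - 2 * nabla l B n
           = (\<lambda>m. fP k m * fM \<beta> k m * A m) (n + unit_vec k) + fQ \<beta> k n * fM \<beta> l n * A n \<and>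
         - 2 * nabla l B n
           = (\<lambda>m. fP j m * fT \<beta> m * A m) (n + unit_vec j + unit_vec k)
             - (\<lambda>m. fQ \<beta> j m * fM \<beta> k m * A m) (n + unit_vec k) \<and>
         - 2 * nabla l B n
           = (\<lambda>m. fP k m * fT \<beta> m * A m) (n + unit_vec j + unit_vec k)
             - (\<lambda>m. fQ \<beta> k m * fM \<beta> j m * A m) (n + unit_vec j)) \<and>
      \<comment> \<open>(vii)\<close>
      (\<beta> \<in> \<nat> \<longrightarrow>
         (\<forall>n. (MAX j. fM \<beta> j n) \<ge> 1 \<longrightarrow> A n = 0) \<and>
         (\<forall>n. (MAX j. fM \<beta> j n) \<ge> 0 \<longrightarrow> B n = 0) \<and>
         finite {n. A n \<noteq> 0 \<or> B n \<noteq> 0}))"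
proof -
  have sol: "is_solution \<beta> (solA \<beta>) (solB \<beta>)"
    by (rule solution_exists[OF assms])
  have uniq: "A = solA \<beta> \<and> B = solB \<beta>" if "is_solution \<beta> A B" for A B
    using solution_unique[OF assms that sol] by blast
  have ex1: "\<exists>!AB. is_solution \<beta> (fst AB) (snd AB)"
  proof
    show "is_solution \<beta> (fst (solA \<beta>, solB \<beta>)) (snd (solA \<beta>, solB \<beta>))"
      using sol by simp
    show "AB = (solA \<beta>, solB \<beta>)" if "is_solution \<beta> (fst AB) (snd AB)" for AB
      using uniq[OF that] by (simp add: prod_eq_iff)
  qed
  have opH: "\<forall>n j k. opH \<beta> j (solA \<beta>) n = opH \<beta> k (solA \<beta>) n"
    using solution_opH[OF sol] by blast
  have rels: "\<forall>n j k l. {j, k, l} = UNIV \<longrightarrow>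
         (\<lambda>m. fP j m * fM \<beta> j m * solA \<beta> m) (n + unit_vec j)
           - (\<lambda>m. fP k m * fM \<beta> k m * solA \<beta> m) (n + unit_vec k)
           = - ((fP j n - fP k n) * fM \<beta> l n * solA \<beta> n) \<and>
         (\<lambda>m. fP j m * fT \<beta> m * solA \<beta> m) (n + unit_vec j)
           - (\<lambda>m. fQ \<beta> k m * fM \<beta> l m * solA \<beta> m) (n - unit_vec k)
           = (fP k n + fQ \<beta> j n) * fM \<beta> k n * solA \<beta> n \<and>
         (\<lambda>m. fQ \<beta> j m * fM \<beta> k m * solA \<beta> m) (n - unit_vec j)
           - (\<lambda>m. fQ \<beta> k m * fM \<beta> j m * solA \<beta> m) (n - unit_vec k)
           = (fP j n - fP k n) * fT \<beta> n * solA \<beta> n"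
    by (intro allI impI conjI)
      (use solA_rel[OF assms] in \<open>unfold rel_up_def rel_mixed_def rel_down_def, blast+\<close>)
  have X: "\<forall>n\<in>octant. \<forall>j k l j' k' l'. {j, k, l} = UNIV \<and> {j', k', l'} = UNIV \<longrightarrow>
         X_plus \<beta> (solA \<beta>) j k l n = X_plus \<beta> (solA \<beta>) j' k' l' n \<and>
         X_minus \<beta> (solA \<beta>) j k l n = X_minus \<beta> (solA \<beta>) j' k' l' n \<and>
         X_plus \<beta> (solA \<beta>) j k l n = X_minus \<beta> (solA \<beta>) j' k' l' n"
    by (intro ballI allI impI conjI; elim conjE; intro X_all_equal[OF assms]; assumption)
  have nablaB: "\<forall>n j k l. {j, k, l} = UNIV \<longrightarrow>
         - 2 * nabla l (solB \<beta>) n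
           = (\<lambda>m. fP j m * fM \<beta> j m * solA \<beta> m) (n + unit_vec j) + fQ \<beta> j n * fM \<beta> l n * solA \<beta> n \<and>
         - 2 * nabla l (solB \<beta>) n
           = (\<lambda>m. fP k m * fM \<beta> k m * solA \<beta> m) (n + unit_vec k) + fQ \<beta> k n * fM \<beta> l n * solA \<beta> n \<and>
         - 2 * nabla l (solB \<beta>) n
           = (\<lambda>m. fP j m * fT \<beta> m * solA \<beta> m) (n + unit_vec j + unit_vec k)
             - (\<lambda>m. fQ \<beta> j m * fM \<beta> k m * solA \<beta> m) (n + unit_vec k) \<and>
         - 2 * nabla l (solB \<beta>) n
           = (\<lambda>m. fP k m * fT \<beta> m * solA \<beta> m) (n + unit_vec j + unit_vec k)
             - (\<lambda>m. fQ \<beta> k m * fM \<beta> j m * solA \<beta> m) (n + unit_vec j)"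
  proof (intro allI impI)
    fix n and j k l :: 3
    assume T: "{j, k, l} = UNIV"
    have "- 2 * nabla l (solB \<beta>) n = flux \<beta> l n"
      by (simp add: nabla_solB[OF assms])
    moreover have comm: "n + unit_vec k + unit_vec j = n + unit_vec j + unit_vec k"
      by (simp add: algebra_simps)
    ultimately show "- 2 * nabla l (solB \<beta>) n
           = (\<lambda>m. fP j m * fM \<beta> j m * solA \<beta> m) (n + unit_vec j) + fQ \<beta> j n * fM \<beta> l n * solA \<beta> n \<and>
         - 2 * nabla l (solB \<beta>) n
           = (\<lambda>m. fP k m * fM \<beta> k m * solA \<beta> m) (n + unit_vec k) + fQ \<beta> k n * fM \<beta> l n * solA \<beta> n \<and>
         - 2 * nabla l (solB \<beta>) n
           = (\<lambda>m. fP j m * fT \<beta> m * solA \<beta> m) (n + unit_vec j + unit_vec k)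
             - (\<lambda>m. fQ \<beta> j m * fM \<beta> k m * solA \<beta> m) (n + unit_vec k) \<and>
         - 2 * nabla l (solB \<beta>) n
           = (\<lambda>m. fP k m * fT \<beta> m * solA \<beta> m) (n + unit_vec j + unit_vec k)
             - (\<lambda>m. fQ \<beta> k m * fM \<beta> j m * solA \<beta> m) (n + unit_vec j)"
      using flux_eq[OF assms T, of n] flux_eq[OF assms triple_perms(1)[OF T], of n]
        flux_eq'[OF assms T, of n] flux_eq'[OF assms triple_perms(1)[OF T], of n, unfolded comm]
      by argo
  qed
  have vanish: "\<beta> \<in> \<nat> \<longrightarrow>
         (\<forall>n. (MAX j. fM \<beta> j n) \<ge> 1 \<longrightarrow> solA \<beta> n = 0) \<and>
         (\<forall>n. (MAX j. fM \<beta> j n) \<ge> 0 \<longrightarrow> solB \<beta> n = 0) \<and>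
         finite {n. solA \<beta> n \<noteq> 0 \<or> solB \<beta> n \<noteq> 0}"
  proof
    assume "\<beta> \<in> \<nat>"
    then obtain b where b: "\<beta> = real b" "b > 0"
      using assms by (auto elim: Nats_cases)
    have "solA \<beta> n = 0" if "(MAX j. fM \<beta> j n) \<ge> 1" for n
      using that solA_vanishes[OF b(2)] by (auto simp: b(1) Max_ge_iff)
    moreover have "solB \<beta> n = 0" if "(MAX j. fM \<beta> j n) \<ge> 0" for n
      using that solB_vanishes[OF b(2)] by (auto simp: b(1) Max_ge_iff)
    moreover have "finite {n. solA \<beta> n \<noteq> 0 \<or> solB \<beta> n \<noteq> 0}"
      unfolding b(1) by (rule solution_finite_support[OF b(2)])
    ultimately show "(\<forall>n. (MAX j. fM \<beta> j n) \<ge> 1 \<longrightarrow> solA \<beta> n = 0) \<and>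
         (\<forall>n. (MAX j. fM \<beta> j n) \<ge> 0 \<longrightarrow> solB \<beta> n = 0) \<and>
         finite {n. solA \<beta> n \<noteq> 0 \<or> solB \<beta> n \<noteq> 0}"
      by simp
  qed
  show ?thesis
  proof (rule conjI[OF ex1], intro allI impI, goal_cases)
    case (1 A B)
    then have AB: "A = solA \<beta>" "B = solB \<beta>"
      using uniq by blast+
    show ?case
      unfolding AB
      by (intro conjI solution_symmetric[OF assms sol] opH rels X nablaB vanish;
          intro allI conjI solA_face[OF assms] solB_face[OF assms])
  qed
qed

end
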